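(* Let $\phi=\begin{pmatrix}0&1\\1&1\end{pmatrix}$ and $\zeta=\begin{pmatrix}0&1\\-1&1\end{pmatrix}$ in $\mathrm{Mat}_2(\mathbb{Z})$. Each exceptional clique of size $4$ in $\mathrm{Mat}_2(\mathbb{Z})$ is equivalent to one of $\{0,1,\phi,\phi+1\}$, $\{0,1,\zeta,1-\phi\}$ or $\{0,1,\zeta,\phi-1\}$, where $0$ and $1$ denote the zero matrix and the identity matrix.
   Context: An exceptional clique in a unital ring $R$ is a subset $C\subseteq R$ such that $u-v$ is a unit of $R$ for all distinct $u,v\in C$. Two exceptional cliques in $R$ are equivalent if they lie in the same orbit under the action on subsets of $R$ of the group generated by the translations $x\mapsto x+r$ ($r\in R$), the left multiplications $x\mapsto ux$ ($u\in R^*$), and the ring automorphisms of $R$. *)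

theory Defs
  imports "HOL-Algebra.Bij" "HOL-Algebra.Generated_Groups" "HOL-Algebra.QuotRing"
    "Jordan_Normal_Form.Matrix"
begin

definition exceptional_clique :: "('a, 'b) ring_scheme \<Rightarrow> 'a set \<Rightarrow> bool" where
  "exceptional_clique R C \<longleftrightarrow>
     C \<subseteq> carrier R \<and>
     (\<forall>u\<in>C. \<forall>v\<in>C. u \<noteq> v \<longrightarrow> u \<ominus>\<^bsub>R\<^esub> v \<in> Units R)"

text \<open>The maps are restricted to the carrier because the elements of
  \<^term>\<open>BijGroup S\<close> are extensional functions.\<close>

definition clique_generators :: "('a, 'b) ring_scheme \<Rightarrow> ('a \<Rightarrow> 'a) set" where
  "clique_generators R =
     {\<lambda>x\<in>carrier R. x \<oplus>\<^bsub>R\<^esub> r | r. r \<in> carrier R} \<union>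
     {\<lambda>x\<in>carrier R. u \<otimes>\<^bsub>R\<^esub> x | u. u \<in> Units R} \<union>
     {restrict h (carrier R) | h. h \<in> ring_iso R R}"

definition clique_group :: "('a, 'b) ring_scheme \<Rightarrow> ('a \<Rightarrow> 'a) set" where
  "clique_group R = generate (BijGroup (carrier R)) (clique_generators R)"

definition clique_equiv :: "('a, 'b) ring_scheme \<Rightarrow> 'a set \<Rightarrow> 'a set \<Rightarrow> bool" where
  "clique_equiv R C D \<longleftrightarrow>
     exceptional_clique R C \<and> exceptional_clique R D \<and> (\<exists>g\<in>clique_group R. g ` C = D)"

text \<open>\<^const>\<open>generate\<close> only yields a subgroup when its argument lies in the carrier.\<close>

lemma clique_generators_subset:
  assumes "ring R"
  shows "clique_generators R \<subseteq> carrier (BijGroup (carrier R))"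
proof -
  interpret ring R by fact
  have t: "bij_betw (\<lambda>x. x \<oplus>\<^bsub>R\<^esub> r) (carrier R) (carrier R)" if r: "r \<in> carrier R" for r
    by (rule bij_betw_byWitness[where f' = "\<lambda>x. x \<ominus>\<^bsub>R\<^esub> r"])
      (use r in \<open>auto simp: a_minus_def a_assoc r_neg l_neg\<close>)
  have m: "bij_betw (\<lambda>x. u \<otimes>\<^bsub>R\<^esub> x) (carrier R) (carrier R)" if u: "u \<in> Units R" for u
    by (rule bij_betw_byWitness[where f' = "\<lambda>x. inv\<^bsub>R\<^esub> u \<otimes>\<^bsub>R\<^esub> x"])
      (use u in \<open>auto simp: m_assoc[symmetric] Units_closed\<close>)
  show ?thesis
    using t m unfolding clique_generators_def BijGroup_def Bij_def ring_iso_def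
    by (auto simp: bij_betw_restrict_eq)
qed

abbreviation Mat2Z :: "int mat ring" where
  "Mat2Z \<equiv> ring_mat TYPE(int) 2 ()"

definition phi_mat :: "int mat" where
  "phi_mat = mat_of_rows_list 2 [[0, 1], [1, 1]]"

definition zeta_mat :: "int mat" where
  "zeta_mat = mat_of_rows_list 2 [[0, 1], [-1, 1]]"

end

theory Submission
  imports Defs
begin

text \<open>Colour the edges of the complete graph on the clique by the sign \<open>det (x - y)\<close>. The maps
  \<open>x \<mapsto> v (x - r) p\<close> with units \<open>v\<close>, \<open>p\<close> belong to the group and change all colours simultaneously or
  none. Three vertices can always be moved to \<open>0, 1, A\<close> with
  \<open>det A = det (A - 1) = e = \<plusminus>1\<close>; reducing a binary quadratic form of discriminant \<open>1 - 4 e\<close> shows that \<open>A\<close>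
  is conjugate to the companion matrix \<open>\<zeta>\<close> (\<open>e = 1\<close>) or \<open>\<phi>\<close> (\<open>e = -1\<close>). Every colouring allows such a
  choice for which the colours leave finitely many fourth vertices: six next to \<open>0, 1, \<zeta>\<close>, in two
  orbits under conjugation by \<open>\<zeta>\<close>, and only \<open>\<phi> + 1\<close> next to \<open>0, 1, \<phi>\<close>.\<close>

section \<open>The clique group of a ring and its affine maps\<close>

text \<open>Multiplication in \<open>BijGroup\<close> is composition only on its carrier, so all
  generated maps must first be known to lie there.\<close>

lemma (in ring) clique_group_closed:
  assumes "f \<in> clique_group R" "g \<in> clique_group R"
  shows "compose (carrier R) f g \<in> clique_group R"
proof -
  have car: "h \<in> carrier (BijGroup (carrier R))" if "h \<in> clique_group R" for h
    using group.generate_in_carrier[OF group_BijGroup clique_generators_subset[OF ring_axioms]] that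
    unfolding clique_group_def by blast
  have "f \<otimes>\<^bsub>BijGroup (carrier R)\<^esub> g \<in> clique_group R"
    using assms unfolding clique_group_def by (rule generate.eng)
  moreover have "f \<otimes>\<^bsub>BijGroup (carrier R)\<^esub> g = compose (carrier R) f g"
    using car[OF assms(1)] car[OF assms(2)] by (simp add: BijGroup_def)
  ultimately show ?thesis by simp
qed

lemma (in ring) clique_equiv_trans:
  assumes "clique_equiv R C D" "clique_equiv R D E"
  shows "clique_equiv R C E"
proof -
  obtain g h where g: "g \<in> clique_group R" "g ` C = D" and h: "h \<in> clique_group R" "h ` D = E"
    using assms unfolding clique_equiv_def by (elim conjE bexE)
  have C: "exceptional_clique R C" and E: "exceptional_clique R E"
    using assms unfolding clique_equiv_def by simp_all
  then have "C \<subseteq> carrier R"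
    unfolding exceptional_clique_def by simp
  then have "compose (carrier R) h g ` C = (\<lambda>x. h (g x)) ` C"
    by (intro image_cong) (auto simp: compose_def)
  also have "\<dots> = E"
    using g(2) h(2) by (simp add: image_image[symmetric])
  finally have "compose (carrier R) h g ` C = E" .
  with clique_group_closed[OF h(1) g(1)] C E show ?thesis
    unfolding clique_equiv_def by (intro conjI bexI)
qed

text \<open>Right multiplications are not among the generators; inner automorphisms combined with
  left multiplications supply them.\<close>

lemma (in ring) conj_ring_iso:
  assumes p: "p \<in> Units R"
  shows "(\<lambda>x. inv p \<otimes> x \<otimes> p) \<in> ring_iso R R"
proof -
  have pc: "p \<in> carrier R" "inv p \<in> carrier R" using p by auto
  have cancel: "p \<otimes> (inv p \<otimes> x) = x" "inv p \<otimes> (p \<otimes> x) = x" if "x \<in> carrier R" for x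
    using p pc that m_assoc[of p "inv p" x] m_assoc[of "inv p" p x] by simp_all
  have "(\<lambda>x. inv p \<otimes> x \<otimes> p) \<in> Ring.ring_hom R R"
  proof (rule ring_hom_memI)
    fix x y assume x: "x \<in> carrier R" and y: "y \<in> carrier R"
    show "inv p \<otimes> x \<otimes> p \<in> carrier R" using pc x by simp
    show "inv p \<otimes> (x \<otimes> y) \<otimes> p = inv p \<otimes> x \<otimes> p \<otimes> (inv p \<otimes> y \<otimes> p)"
      using pc x y by (simp add: m_assoc cancel)
    show "inv p \<otimes> (x \<oplus> y) \<otimes> p = inv p \<otimes> x \<otimes> p \<oplus> inv p \<otimes> y \<otimes> p"
      using pc x y by (simp add: l_distr r_distr)
  next
    show "inv p \<otimes> \<one> \<otimes> p = \<one>" using p pc by simp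
  qed
  moreover have "bij_betw (\<lambda>x. inv p \<otimes> x \<otimes> p) (carrier R) (carrier R)"
  proof (rule bij_betw_byWitness[where f' = "\<lambda>x. p \<otimes> x \<otimes> inv p"])
    show "\<forall>x\<in>carrier R. p \<otimes> (inv p \<otimes> x \<otimes> p) \<otimes> inv p = x"
      "\<forall>x\<in>carrier R. inv p \<otimes> (p \<otimes> x \<otimes> inv p) \<otimes> p = x"
      using p pc by (simp_all add: m_assoc cancel)
    show "(\<lambda>x. inv p \<otimes> x \<otimes> p) ` carrier R \<subseteq> carrier R"
      "(\<lambda>x. p \<otimes> x \<otimes> inv p) ` carrier R \<subseteq> carrier R"
      using pc by (simp_all add: image_subset_iff)
  qed
  ultimately show ?thesis unfolding ring_iso_def by simp
qed

text \<open>Translate by \<open>-r\<close>, multiply on the left by \<open>p v\<close>, then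
  conjugate by \<open>p\<close>: the left factor \<open>inv p\<close> of the conjugation cancels
  \<open>p\<close>, and its right factor \<open>p\<close> remains.\<close>

lemma (in ring) affine_in_clique_group:
  assumes r: "r \<in> carrier R" and v: "v \<in> Units R" and p: "p \<in> Units R"
  shows "(\<lambda>x\<in>carrier R. v \<otimes> (x \<ominus> r) \<otimes> p) \<in> clique_group R" (is "?F \<in> _")
proof -
  have pc: "p \<in> carrier R" "inv p \<in> carrier R" "v \<in> carrier R" using v p by auto
  let ?t = "\<lambda>x\<in>carrier R. x \<oplus> (\<ominus> r)"
  let ?u = "\<lambda>x\<in>carrier R. (p \<otimes> v) \<otimes> x"
  let ?c = "restrict (\<lambda>x. inv p \<otimes> x \<otimes> p) (carrier R)"
  have "\<ominus> r \<in> carrier R" "p \<otimes> v \<in> Units R" using r v p by simp_all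
  then have "?t \<in> clique_generators R" "?u \<in> clique_generators R" "?c \<in> clique_generators R"
    using conj_ring_iso[OF p] unfolding clique_generators_def by blast+
  then have "compose (carrier R) ?c (compose (carrier R) ?u ?t) \<in> clique_group R"
    by (intro clique_group_closed) (auto simp: clique_group_def intro: generate.incl)
  moreover have "compose (carrier R) ?c (compose (carrier R) ?u ?t) = ?F"
  proof
    fix x
    have "inv p \<otimes> (p \<otimes> v \<otimes> y) \<otimes> p = v \<otimes> y \<otimes> p" if "y \<in> carrier R" for y
    proof -
      have "inv p \<otimes> (p \<otimes> v \<otimes> y) = (inv p \<otimes> p) \<otimes> v \<otimes> y"
        using pc that by (simp only: m_assoc m_closed)
      then show ?thesis using p pc that by simp
    qed
    then show "compose (carrier R) ?c (compose (carrier R) ?u ?t) x = ?F x"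
      using r pc by (simp add: compose_def a_minus_def)
  qed
  ultimately show ?thesis by simp
qed

text \<open>Differences \<open>x - y\<close> become \<open>v (x - y) p\<close>, a product of units,
  so the image is again a clique.\<close>

lemma (in ring) clique_equiv_affine:
  assumes C: "exceptional_clique R C"
    and r: "r \<in> carrier R" and v: "v \<in> Units R" and p: "p \<in> Units R"
  shows "clique_equiv R C ((\<lambda>x. v \<otimes> (x \<ominus> r) \<otimes> p) ` C)" (is "clique_equiv R C (?f ` C)")
proof -
  have sub: "C \<subseteq> carrier R" using C unfolding exceptional_clique_def by blast
  have pc: "p \<in> carrier R" "v \<in> carrier R" using v p by auto
  have diff: "?f x \<ominus> ?f y = v \<otimes> (x \<ominus> y) \<otimes> p" if "x \<in> carrier R" "y \<in> carrier R" for x y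
  proof -
    have "x \<ominus> y = (x \<ominus> r) \<ominus> (y \<ominus> r)"
      using that r by (simp add: a_minus_def minus_add a_ac r_neg1 r_neg2)
    then show ?thesis
      using that r pc by (simp add: a_minus_def l_distr r_distr l_minus r_minus)
  qed
  have "exceptional_clique R (?f ` C)"
    unfolding exceptional_clique_def
  proof (intro conjI ballI impI)
    show "?f ` C \<subseteq> carrier R" using sub r pc by auto
    fix a b assume "a \<in> ?f ` C" "b \<in> ?f ` C" "a \<noteq> b"
    then obtain x y where xy: "x \<in> C" "y \<in> C" "a = ?f x" "b = ?f y" "x \<noteq> y" by auto
    then have "x \<ominus> y \<in> Units R" using C unfolding exceptional_clique_def by blast
    moreover have "a \<ominus> b = v \<otimes> (x \<ominus> y) \<otimes> p" using xy sub diff by blast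
    ultimately show "a \<ominus> b \<in> Units R" using v p by simp
  qed
  moreover have "(\<lambda>x\<in>carrier R. ?f x) ` C = ?f ` C" using sub by (auto simp: image_iff)
  ultimately show ?thesis
    using C affine_in_clique_group[OF r v p] unfolding clique_equiv_def by metis
qed

section \<open>Two-by-two matrices by entries\<close>

text \<open>Writing matrices by their entries lets the simplifier turn matrix identities into
  polynomial identities.\<close>

definition mat22 :: "'a \<Rightarrow> 'a \<Rightarrow> 'a \<Rightarrow> 'a \<Rightarrow> 'a mat" where
  "mat22 a b c d = mat_of_rows_list 2 [[a, b], [c, d]]"

definition det22 :: "'a::comm_ring_1 mat \<Rightarrow> 'a" where
  "det22 A = A $$ (0,0) * A $$ (1,1) - A $$ (0,1) * A $$ (1,0)"

lemma mat22_index [simp]: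
  "mat22 a b c d $$ (0,0) = a" "mat22 a b c d $$ (0,Suc 0) = b"
  "mat22 a b c d $$ (Suc 0,0) = c" "mat22 a b c d $$ (Suc 0,Suc 0) = d"
  by (simp_all add: mat22_def mat_of_rows_list_def)

lemma mat22_dim [simp]: "dim_row (mat22 a b c d) = 2" "dim_col (mat22 a b c d) = 2"
  by (simp_all add: mat22_def mat_of_rows_list_def)

lemma mat22_carrier [simp]: "mat22 a b c d \<in> carrier_mat 2 2"
  by (rule carrier_matI) simp_all

lemma eq_mat22I:
  assumes "A \<in> carrier_mat 2 2"
    "A $$ (0,0) = a" "A $$ (0,1) = b" "A $$ (1,0) = c" "A $$ (1,1) = d"
  shows "A = mat22 a b c d"
  using assms by (intro eq_matI) (auto simp: less_2_cases_iff)

lemma mat22_cases: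
  assumes "A \<in> carrier_mat 2 2"
  obtains a b c d where "A = mat22 a b c d"
  using eq_mat22I[OF assms] by blast

lemma mat22_eq_iff [simp]:
  "mat22 a b c d = mat22 a' b' c' d' \<longleftrightarrow> a = a' \<and> b = b' \<and> c = c' \<and> d = d'"
  by (metis mat22_index)

lemma mat22_mult [simp]:
  fixes a :: "'a::comm_ring_1"
  shows "mat22 a b c d * mat22 a' b' c' d' =
    mat22 (a*a' + b*c') (a*b' + b*d') (c*a' + d*c') (c*b' + d*d')"
  by (rule eq_mat22I) (auto simp: scalar_prod_def numeral_2_eq_2 intro!: mult_carrier_mat[of _ 2 2])

lemma mat22_diff [simp]:
  fixes a :: "'a::comm_ring_1"
  shows "mat22 a b c d - mat22 a' b' c' d' = mat22 (a-a') (b-b') (c-c') (d-d')"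
  by (rule eq_mat22I) auto

lemma mat22_add [simp]:
  fixes a :: "'a::comm_ring_1"
  shows "mat22 a b c d + mat22 a' b' c' d' = mat22 (a+a') (b+b') (c+c') (d+d')"
  by (rule eq_mat22I) auto

lemma zero_mat22: "0\<^sub>m 2 2 = mat22 0 0 0 0"
  by (rule eq_mat22I) auto

lemma one_mat22: "1\<^sub>m 2 = mat22 1 0 0 1"
  by (rule eq_mat22I) auto

lemma phi_mat22: "phi_mat = mat22 0 1 1 1"
  by (simp add: phi_mat_def mat22_def)

lemma zeta_mat22: "zeta_mat = mat22 0 1 (-1) 1"
  by (simp add: zeta_mat_def mat22_def)

lemma det22_mat22 [simp]: "det22 (mat22 a b c d) = a*d - b*c"
  by (simp add: det22_def)

lemma det22_one: "det22 (1\<^sub>m 2) = 1"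
  by (simp add: one_mat22)

lemma det22_mult:
  assumes "A \<in> carrier_mat 2 2" "B \<in> carrier_mat 2 2"
  shows "det22 (A * B) = det22 A * det22 B"
  using assms by (elim mat22_cases) (simp add: algebra_simps)

lemma det22_minus_commute:
  assumes "A \<in> carrier_mat 2 2" "B \<in> carrier_mat 2 2"
  shows "det22 (A - B) = det22 (B - A)"
  using assms by (elim mat22_cases) (simp add: algebra_simps)

section \<open>The ring of integer two-by-two matrices and its units\<close>

interpretation Mat2Z: ring Mat2Z
  by (rule ring_mat)

lemma Mat2Z_simps:
  "carrier Mat2Z = carrier_mat 2 2" "monoid.mult Mat2Z = (*)" "one Mat2Z = 1\<^sub>m 2"
  "zero Mat2Z = 0\<^sub>m 2 2" "add Mat2Z = (+)"
  by (simp_all add: ring_mat_def)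

text \<open>Negation in the ring is the abstract additive inverse; uniqueness of that inverse
  identifies it with subtraction from the zero matrix.\<close>

lemma Mat2Z_minus:
  assumes "A \<in> carrier_mat 2 2" "B \<in> carrier_mat 2 2"
  shows "A \<ominus>\<^bsub>Mat2Z\<^esub> B = A - B"
proof -
  have "\<ominus>\<^bsub>Mat2Z\<^esub> B = 0\<^sub>m 2 2 - B"
    by (rule Mat2Z.minus_equality)
      (use assms(2) in \<open>auto simp: Mat2Z_simps zero_mat22 elim!: mat22_cases\<close>)
  then show ?thesis
    using assms unfolding a_minus_def Mat2Z_simps
    by (auto simp: zero_mat22 elim!: mat22_cases)
qed

lemma Units_Mat2Z: "A \<in> Units Mat2Z \<longleftrightarrow> A \<in> carrier_mat 2 2 \<and> (det22 A = 1 \<or> det22 A = -1)"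
proof (intro iffI conjI)
  assume A: "A \<in> Units Mat2Z"
  then show c: "A \<in> carrier_mat 2 2" using Mat2Z.Units_closed Mat2Z_simps by blast
  obtain B where B: "B \<in> carrier_mat 2 2" "A * B = 1\<^sub>m 2"
    using A unfolding Units_def by (auto simp: Mat2Z_simps)
  then have "det22 A * det22 B = 1" using c by (metis det22_mult det22_one)
  then show "det22 A = 1 \<or> det22 A = -1" using zmult_eq_1_iff by blast
next
  assume A: "A \<in> carrier_mat 2 2 \<and> (det22 A = 1 \<or> det22 A = -1)"
  then obtain a b c d where abcd: "A = mat22 a b c d" by (auto elim: mat22_cases)
  let ?e = "a*d - b*c"
  have e: "?e * ?e = 1" using A abcd by auto
  \<comment> \<open>The adjugate times the determinant \<open>?e\<close>; it is the inverse because
    \<open>?e * ?e = 1\<close>.\<close>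
  let ?B = "mat22 (?e*d) (-?e*b) (-?e*c) (?e*a)"
  have "A * ?B = 1\<^sub>m 2" "?B * A = 1\<^sub>m 2"
    using e by (simp_all add: abcd one_mat22 algebra_simps)
  then show "A \<in> Units Mat2Z"
    using A mat22_carrier unfolding Units_def by (auto simp: Mat2Z_simps)
qed

lemma Mat2Z_clique_equiv_affine:
  assumes C: "exceptional_clique Mat2Z C"
    and r: "r \<in> carrier_mat 2 2" and v: "v \<in> Units Mat2Z" and p: "p \<in> Units Mat2Z"
  shows "clique_equiv Mat2Z C ((\<lambda>x. v * (x - r) * p) ` C)"
proof -
  have "C \<subseteq> carrier_mat 2 2"
    using C unfolding exceptional_clique_def by (simp add: Mat2Z_simps)
  then have "(\<lambda>x. v \<otimes>\<^bsub>Mat2Z\<^esub> (x \<ominus>\<^bsub>Mat2Z\<^esub> r) \<otimes>\<^bsub>Mat2Z\<^esub> p) ` C = (\<lambda>x. v * (x - r) * p) ` C"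
    using r by (intro image_cong) (auto simp: Mat2Z_simps(2) Mat2Z_minus)
  with Mat2Z.clique_equiv_affine[OF C _ v p, of r] r show ?thesis
    by (simp add: Mat2Z_simps(1))
qed

section \<open>Reduction of binary quadratic forms and companion matrices\<close>

text \<open>Gauss reduction by descent on the leading coefficient: a shift of \<open>x\<close> makes
  the middle coefficient small, a swap of the variables makes the leading one smaller, and a form
  that admits no further descent has leading coefficient 1 or -1.\<close>

lemma binary_form_represents_unit:
  fixes p q r :: int
  assumes "q\<^sup>2 - 4*p*r = -3 \<or> q\<^sup>2 - 4*p*r = 5"
  shows "\<exists>x y. \<bar>p*x\<^sup>2 + q*x*y + r*y\<^sup>2\<bar> = 1"
  using assms
proof (induction "nat \<bar>p\<bar>" arbitrary: p q r rule: less_induct)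
  case less
  \<comment> \<open>Otherwise the discriminant would be a square, which neither -3 nor 5 is.\<close>
  have p0: "p \<noteq> 0"
  proof
    assume "p = 0"
    then have "q\<^sup>2 = 5" using less.prems by (auto simp: power2_eq_square) (metis not_square_less_zero neg_less_0_iff_less zero_less_numeral)
    then have "\<bar>q\<bar> < 3" "\<bar>q\<bar> > 2"
      using power2_less_imp_less[of "\<bar>q\<bar>" 3] power2_less_imp_less[of 2 "\<bar>q\<bar>"] by auto
    then show False by linarith
  qed
  \<comment> \<open>This shift replaces \<open>q\<close> by its residue modulo
    \<open>2 * \<bar>p\<bar>\<close> of least absolute value; \<open>sgn p\<close> adjusts the sign,
    since \<open>q\<close> moves by multiples of \<open>2 * p\<close>.\<close>
  define k where "k = - ((q + \<bar>p\<bar>) div (2 * \<bar>p\<bar>)) * sgn p"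
  define q' where "q' = q + 2*k*p"
  define r' where "r' = p*k\<^sup>2 + q*k + r"
  have "q' = (q + \<bar>p\<bar>) mod (2 * \<bar>p\<bar>) - \<bar>p\<bar>"
    unfolding q'_def k_def minus_div_mult_eq_mod[symmetric]
    by (cases "p > 0") (auto simp: algebra_simps sgn_if)
  moreover have m: "0 < 2 * \<bar>p\<bar>" using p0 by simp
  ultimately have q': "\<bar>q'\<bar> \<le> \<bar>p\<bar>"
    using pos_mod_bound[OF m, of "q+\<bar>p\<bar>"] pos_mod_sign[OF m, of "q+\<bar>p\<bar>"]
    by (simp only: abs_le_iff) linarith
  have disc: "q'\<^sup>2 - 4*p*r' = q\<^sup>2 - 4*p*r"
    unfolding q'_def r'_def by (simp add: power2_eq_square algebra_simps)
  have subst: "p*x\<^sup>2 + q'*x*y + r'*y\<^sup>2 = p*(x+k*y)\<^sup>2 + q*(x+k*y)*y + r*y\<^sup>2" for x y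
    unfolding q'_def r'_def by (simp add: power2_eq_square algebra_simps)
  have "\<exists>x y. \<bar>p*x\<^sup>2 + q'*x*y + r'*y\<^sup>2\<bar> = 1"
  proof (cases "\<bar>r'\<bar> < \<bar>p\<bar>")
    case True
    have "q'\<^sup>2 - 4*r'*p = -3 \<or> q'\<^sup>2 - 4*r'*p = 5" using disc less.prems by (simp add: ac_simps)
    then obtain x y where "\<bar>r'*x\<^sup>2 + q'*x*y + p*y\<^sup>2\<bar> = 1" using less.hyps[of r' q' p] True p0 by auto
    then have "\<bar>p*y\<^sup>2 + q'*y*x + r'*x\<^sup>2\<bar> = 1" by (simp add: ac_simps)
    then show ?thesis by blast
  next
    case False
    have "q'\<^sup>2 \<le> p\<^sup>2" using q' by (simp add: abs_le_square_iff)
    moreover have "p\<^sup>2 \<le> \<bar>p * r'\<bar>"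
    proof -
      have "\<bar>p\<bar> * \<bar>p\<bar> \<le> \<bar>p\<bar> * \<bar>r'\<bar>" using False by (intro mult_left_mono) auto
      then show ?thesis by (simp add: power2_eq_square abs_mult)
    qed
    moreover have "4 * \<bar>p * r'\<bar> \<le> q'\<^sup>2 + 5"
    proof -
      have "q'\<^sup>2 - 4 * (p * r') = -3 \<or> q'\<^sup>2 - 4 * (p * r') = 5"
        using disc less.prems by (simp add: mult.assoc)
      then show ?thesis using zero_le_power2[of q'] by linarith
    qed
    \<comment> \<open>The three bounds combine to \<open>4 p^2 <= p^2 + 5\<close>.\<close>
    ultimately have "p\<^sup>2 < 2\<^sup>2" by simp
    then have "\<bar>p\<bar> < 2" using power2_less_imp_less[of "\<bar>p\<bar>" 2] by simp
    then have "\<bar>p*1\<^sup>2 + q'*1*0 + r'*0\<^sup>2\<bar> = 1" using p0 by simp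
    then show ?thesis by blast
  qed
  then show ?case unfolding subst by blast
qed

text \<open>The two determinants force trace 1, hence \<open>A^2 = A - e\<close>. The determinant of
  the pair \<open>w\<close>, \<open>A w\<close> is a binary form in \<open>w\<close> of discriminant
  \<open>1 - 4 e\<close>; where it is 1 or -1, the vectors \<open>w\<close> and
  \<open>-e A w\<close> form a basis of the lattice in which \<open>A\<close> acts as the companion
  matrix.\<close>

lemma companion_conj:
  fixes A :: "int mat"
  assumes A: "A \<in> carrier_mat 2 2"
    and e: "e = 1 \<or> e = -1" "det22 A = e" "det22 (A - 1\<^sub>m 2) = e"
  shows "\<exists>Q \<in> Units Mat2Z. A * Q = Q * mat22 0 1 (-e) 1"
proof -
  obtain a b c d where abcd: "A = mat22 a b c d" using A by (rule mat22_cases)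
  have d: "d = 1 - a" using e(2,3) by (simp add: abcd one_mat22 algebra_simps)
  have det: "a*(1-a) - b*c = e" using e(2) by (simp add: abcd d)
  have "(1-2*a)\<^sup>2 - 4*c*(-b) = 1 - 4*e"
    unfolding det[symmetric] by (simp add: power2_eq_square algebra_simps)
  then obtain x y where xy: "\<bar>c*x\<^sup>2 + (1-2*a)*x*y + (-b)*y\<^sup>2\<bar> = 1"
    using binary_form_represents_unit[of "1-2*a" c "-b"] e(1) by auto
  \<comment> \<open>The columns of \<open>Q\<close> are \<open>(x, y)\<close> and \<open>-e A (x, y)\<close>.\<close>
  define w1 w2 where w: "w1 = a*x + b*y" "w2 = c*x + (1-a)*y"
  let ?Q = "mat22 x (-e*w1) y (-e*w2)"
  have "det22 ?Q = -e * (c*x\<^sup>2 + (1-2*a)*x*y + (-b)*y\<^sup>2)"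
    by (simp add: w power2_eq_square algebra_simps)
  then have "?Q \<in> Units Mat2Z" using e(1) xy by (auto simp: Units_Mat2Z abs_if split: if_splits)
  moreover have "A * ?Q = ?Q * mat22 0 1 (-e) 1"
  proof -
    \<comment> \<open>Facts \<open>1\<close> and \<open>2\<close> below are the coordinates of
      \<open>A^2 w = A w - e w\<close>.\<close>
    have bc: "b*c = a*(1-a) - e" using det by simp
    have "a*w1 + b*w2 = a*a*x + (b*c)*x + b*y" by (simp add: w algebra_simps)
    then have 1: "a*w1 + b*w2 = w1 - e*x" unfolding bc by (simp add: w algebra_simps)
    have "c*w1 + (1-a)*w2 = c*x + (b*c)*y + (1-a)*(1-a)*y" by (simp add: w algebra_simps)
    then have 2: "c*w1 + (1-a)*w2 = w2 - e*y" unfolding bc by (simp add: w algebra_simps)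
    have "a*x + b*y = w1" "c*x + (1-a)*y = w2" by (simp_all add: w)
    moreover have "a*(-e*w1) + b*(-e*w2) = x - e*w1"
    proof -
      have "a*(-e*w1) + b*(-e*w2) = -e*(a*w1 + b*w2)" by (simp add: algebra_simps)
      then show ?thesis unfolding 1 using e(1) by auto
    qed
    moreover have "c*(-e*w1) + (1-a)*(-e*w2) = y - e*w2"
    proof -
      have "c*(-e*w1) + (1-a)*(-e*w2) = -e*(c*w1 + (1-a)*w2)" by (simp add: algebra_simps)
      then show ?thesis unfolding 2 using e(1) by auto
    qed
    moreover have "-e*w1*(-e) = w1" "-e*w2*(-e) = w2" using e(1) by auto
    ultimately show ?thesis unfolding abcd d mat22_mult mat22_eq_iff
      by (intro conjI) simp_all
  qed
  ultimately show ?thesis by blast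
qed

text \<open>Left multiplication by the inverse of \<open>x1 - x0\<close> after translation sends
  \<open>x0\<close>, \<open>x1\<close> to 0, 1 and \<open>x2\<close> to some \<open>A\<close>;
  conjugation by \<open>Q\<close> then fixes 0 and 1 and brings \<open>A\<close> into companion
  form. The last conclusion says that all signs are multiplied by the same factor.\<close>

lemma normalise_triangle:
  assumes C: "exceptional_clique Mat2Z C"
    and x: "x0 \<in> C" "x1 \<in> C" "x2 \<in> C" "x1 \<noteq> x0"
    and e: "e = 1 \<or> e = -1"
      "det22 (x2 - x0) = e * det22 (x1 - x0)" "det22 (x2 - x1) = e * det22 (x1 - x0)"
  shows "\<exists>f. clique_equiv Mat2Z C (f ` C) \<and>
    f x0 = 0\<^sub>m 2 2 \<and> f x1 = 1\<^sub>m 2 \<and> f x2 = mat22 0 1 (-e) 1 \<and>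
    (\<forall>x\<in>C. f x \<in> carrier_mat 2 2) \<and>
    (\<forall>x\<in>C. \<forall>y\<in>C. det22 (f x - f y) = det22 (x1 - x0) * det22 (x - y))"
proof -
  have car: "x \<in> carrier_mat 2 2" if "x \<in> C" for x
    using C that unfolding exceptional_clique_def by (auto simp: Mat2Z_simps)
  note xc = car[OF x(1)] car[OF x(2)] car[OF x(3)]
  define u where "u = x1 - x0"
  define s where "s = det22 u"
  have u: "u \<in> Units Mat2Z"
    using C x Mat2Z_minus[OF xc(2,1)] unfolding exceptional_clique_def u_def by metis
  then have uc: "u \<in> carrier_mat 2 2" and ss: "s * s = 1" by (auto simp: Units_Mat2Z s_def)
  define v where "v = inv\<^bsub>Mat2Z\<^esub> u"
  have v: "v \<in> Units Mat2Z" using Mat2Z.Units_inv_Units[OF u] by (simp add: v_def)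
  then have vc: "v \<in> carrier_mat 2 2" by (simp add: Units_Mat2Z)
  have vu: "v * u = 1\<^sub>m 2" using Mat2Z.Units_l_inv[OF u] by (simp add: Mat2Z_simps v_def)
  have "det22 v * s = 1" using vu vc uc by (metis det22_mult det22_one s_def)
  \<comment> \<open>Since \<open>s\<close> is 1 or -1, it is its own inverse.\<close>
  then have dv: "det22 v = s" using ss by (metis mult.assoc mult.commute mult_1)
  define A where "A = v * (x2 - x0)"
  have Ac: "A \<in> carrier_mat 2 2" unfolding A_def using vc xc by auto
  have "A - 1\<^sub>m 2 = v * ((x2 - x0) - u)"
    unfolding A_def using mult_minus_distrib_mat[OF vc minus_carrier_mat[OF xc(1)] uc] vu by simp
  also have "(x2 - x0) - u = x2 - x1" unfolding u_def using xc by (elim mat22_cases) simp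
  finally have A1: "A - 1\<^sub>m 2 = v * (x2 - x1)" .
  have "det22 A = e" "det22 (A - 1\<^sub>m 2) = e"
    using det22_mult[OF vc minus_carrier_mat[OF xc(1)], of x2]
      det22_mult[OF vc minus_carrier_mat[OF xc(2)], of x2] ss e(2,3)
    unfolding A1 unfolding A_def dv by (simp_all add: u_def[symmetric] s_def[symmetric] ac_simps)
  then obtain Q where Q: "Q \<in> Units Mat2Z" "A * Q = Q * mat22 0 1 (-e) 1"
    using companion_conj[OF Ac e(1)] by blast
  define P where "P = inv\<^bsub>Mat2Z\<^esub> Q"
  have P: "P \<in> Units Mat2Z" using Mat2Z.Units_inv_Units[OF Q(1)] by (simp add: P_def)
  have PQ: "P * Q = 1\<^sub>m 2" using Mat2Z.Units_l_inv[OF Q(1)] by (simp add: Mat2Z_simps P_def)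
  have PQc: "P \<in> carrier_mat 2 2" "Q \<in> carrier_mat 2 2" using P Q(1) by (simp_all add: Units_Mat2Z)
  have dPQ: "det22 P * det22 Q = 1" using PQ PQc by (metis det22_mult det22_one)
  define f where "f = (\<lambda>x. (P * v) * (x - x0) * Q)"
  have Pv: "P * v \<in> Units Mat2Z" using Mat2Z.Units_m_closed[OF P v] by (simp add: Mat2Z_simps)
  have Pvc: "P * v \<in> carrier_mat 2 2" using PQc vc by simp
  have f: "f x = P * (v * (x - x0) * Q)" if "x \<in> carrier_mat 2 2" for x
  proof -
    have y: "x - x0 \<in> carrier_mat 2 2" "v * (x - x0) \<in> carrier_mat 2 2" using xc(1) vc by auto
    show ?thesis
      unfolding f_def using assoc_mult_mat[OF PQc(1) vc y(1)] assoc_mult_mat[OF PQc(1) y(2) PQc(2)]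
      by simp
  qed
  have "clique_equiv Mat2Z C (f ` C)"
    unfolding f_def by (rule Mat2Z_clique_equiv_affine[OF C xc(1) Pv Q(1)])
  moreover have "f x0 = 0\<^sub>m 2 2"
  proof -
    have "x0 - x0 = 0\<^sub>m 2 2" using xc(1) by auto
    then show ?thesis
      using right_mult_zero_mat[OF Pvc, of 2] left_mult_zero_mat[OF PQc(2), of 2]
      by (simp add: f_def)
  qed
  moreover have "f x1 = 1\<^sub>m 2"
    using f[OF xc(2)] vu PQ PQc by (simp add: u_def)
  moreover have "f x2 = mat22 0 1 (-e) 1"
  proof -
    have "f x2 = (P * Q) * mat22 0 1 (-e) 1"
      using f[OF xc(3)] Q(2) PQc by (simp add: A_def assoc_mult_mat[of _ 2 2 _ 2 _ 2])
    then show ?thesis by (simp add: PQ left_mult_one_mat[OF mat22_carrier])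
  qed
  moreover have "f x \<in> carrier_mat 2 2" if "x \<in> C" for x
    using car[OF that] xc(1) Pvc PQc by (auto simp: f_def)
  moreover have "det22 (f x - f y) = s * det22 (x - y)" if "x \<in> C" "y \<in> C" for x y
  proof -
    note xy = car[OF that(1)] car[OF that(2)]
    have "(x - x0) - (y - x0) = x - y" using xy xc(1) by (elim mat22_cases) simp
    moreover have "x - x0 \<in> carrier_mat 2 2" "y - x0 \<in> carrier_mat 2 2"
      using xc(1) by auto
    ultimately have "f x - f y = (P * v) * (x - y) * Q"
      using mult_minus_distrib_mat[of "P * v" 2 2 "x - x0" 2 "y - x0"]
        minus_mult_distrib_mat[of "P * v * (x - x0)" 2 2 "P * v * (y - x0)" Q 2]
        mult_carrier_mat[OF Pvc, of _ 2] PQc(2) Pvc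
      by (simp add: f_def)
    then have "det22 (f x - f y) = (det22 P * det22 Q) * (s * det22 (x - y))"
      using det22_mult[OF mult_carrier_mat[OF Pvc minus_carrier_mat[OF xy(2)]] PQc(2), of x]
        det22_mult[OF Pvc minus_carrier_mat[OF xy(2)], of x] det22_mult[OF PQc(1) vc]
      by (simp add: dv ac_simps)
    then show ?thesis by (simp add: dPQ)
  qed
  ultimately show ?thesis unfolding s_def u_def by blast
qed

section \<open>Two-colourings of the edges of the complete graph on four vertices\<close>

text \<open>If a triangle is monochromatic, two of the three edges from the fourth vertex to it
  agree, and \<open>x1\<close>, \<open>x2\<close> are chosen as their ends. Otherwise the colour
  classes are two paths, or a 4-cycle and a perfect matching; both fit the case \<open>path\<close>,
  in which the edge from \<open>x3\<close> to \<open>x0\<close> is left free.\<close>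

lemma two_colouring_K4:
  assumes C: "card C = 4" and sym: "\<forall>x\<in>C. \<forall>y\<in>C. S x y \<longleftrightarrow> S y x"
  obtains (mono) x0 x1 x2 x3 where "C = {x0, x1, x2, x3}" "distinct [x0, x1, x2, x3]"
      "S x2 x0 \<longleftrightarrow> S x1 x0" "S x2 x1 \<longleftrightarrow> S x1 x0" "S x3 x1 \<longleftrightarrow> S x3 x2"
  | (path) x0 x1 x2 x3 where "C = {x0, x1, x2, x3}" "distinct [x0, x1, x2, x3]"
      "S x2 x0 \<longleftrightarrow> \<not> S x1 x0" "S x2 x1 \<longleftrightarrow> \<not> S x1 x0"
      "S x3 x1 \<longleftrightarrow> \<not> S x1 x0" "S x3 x2 \<longleftrightarrow> S x1 x0"
proof -
  obtain xs where xs: "set xs = C" "distinct xs" "length xs = 4"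
    using C by (metis card.infinite distinct_card finite_distinct_list zero_neq_numeral)
  then obtain a b c d where "xs = [a, b, c, d]"
    by (auto simp: length_Suc_conv eval_nat_numeral)
  with xs have abcd: "C = {a, b, c, d}" "distinct [a, b, c, d]" by auto
  define M where "M x0 x1 x2 x3 \<longleftrightarrow>
    (S x2 x0 \<longleftrightarrow> S x1 x0) \<and> (S x2 x1 \<longleftrightarrow> S x1 x0) \<and> (S x3 x1 \<longleftrightarrow> S x3 x2)" for x0 x1 x2 x3
  define N where "N x0 x1 x2 x3 \<longleftrightarrow> (S x2 x0 \<longleftrightarrow> \<not> S x1 x0) \<and> (S x2 x1 \<longleftrightarrow> \<not> S x1 x0) \<and>
      (S x3 x1 \<longleftrightarrow> \<not> S x1 x0) \<and> (S x3 x2 \<longleftrightarrow> S x1 x0)" for x0 x1 x2 x3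
  have hit: thesis if "M x0 x1 x2 x3 \<or> N x0 x1 x2 x3"
    "{x0, x1, x2, x3} = {a, b, c, d}" "distinct [x0, x1, x2, x3]" for x0 x1 x2 x3
    using that mono path abcd unfolding M_def N_def by metis
  have s: "S b a = S a b" "S c a = S a c" "S d a = S a d" "S c b = S b c" "S d b = S b d" "S d c = S c d"
    by (rule sym[rule_format]; simp add: abcd(1))+
  \<comment> \<open>\<open>M\<close> is symmetric in \<open>x1\<close> and \<open>x2\<close>, so 12
    orderings suffice; for \<open>N\<close> all 24 are listed.\<close>
  have "M a b c d \<or> M b a c d \<or> M c a b d \<or> M a b d c \<or> M b a d c \<or> M d a b c \<or>
    M a c d b \<or> M c a d b \<or> M d a c b \<or> M b c d a \<or> M c b d a \<or> M d b c a \<or>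
    N a b c d \<or> N a b d c \<or> N a c b d \<or> N a c d b \<or> N a d b c \<or> N a d c b \<or>
    N b a c d \<or> N b a d c \<or> N b c a d \<or> N b c d a \<or> N b d a c \<or> N b d c a \<or>
    N c a b d \<or> N c a d b \<or> N c b a d \<or> N c b d a \<or> N c d a b \<or> N c d b a \<or>
    N d a b c \<or> N d a c b \<or> N d b a c \<or> N d b c a \<or> N d c a b \<or> N d c b a"
    unfolding M_def N_def s
    by (cases "S a b"; cases "S a c"; cases "S a d"; cases "S b c"; cases "S b d"; cases "S c d"; simp)
  then show thesis
    using abcd(2) by (elim disjE) (erule hit[OF disjI1] hit[OF disjI2]; auto)+
qed

section \<open>Possible fourth vertices\<close>

lemma int_abs_le_of_square_le:
  fixes z b :: int
  assumes "z * z \<le> b * b" "0 \<le> b"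
  shows "-b \<le> z \<and> z \<le> b"
  using assms abs_le_square_iff[of z b] by (auto simp: power2_eq_square)

text \<open>Differences of the three determinant equations are linear and eliminate \<open>r\<close>
  and \<open>s\<close>. What is left is an ellipse in \<open>p\<close> and \<open>q\<close>, so a
  bounded search finishes.\<close>

lemma zeta_clique_completions:
  fixes B :: "int mat"
  assumes B: "B \<in> carrier_mat 2 2"
    and dets: "det22 B = a" "det22 (B - 1\<^sub>m 2) = b" "det22 (B - zeta_mat) = b"
    and ab: "a = 1 \<or> a = -1" "b = 1 \<or> b = -1"
  shows "B \<in> {mat22 1 1 1 0, mat22 (-1) 1 (-1) 2, mat22 1 (-1) (-1) 0,
    mat22 1 (-1) 1 (-2), mat22 (-1) (-1) (-1) 0, mat22 (-1) 1 1 0}"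
proof -
  obtain p q r s where pqrs: "B = mat22 p q r s" using B by (rule mat22_cases)
  have s: "s = a - b + 1 - p" and r: "r = b - a + p + q - 1" and det: "p*s - q*r = a"
    using dets by (simp_all add: pqrs one_mat22 zeta_mat22 algebra_simps)
  have "p*p + p*q + q*q - (a-b+1)*(p+q) + a = 0"
    using det unfolding s r by (simp add: algebra_simps)
  then have eq: "4*(p*p) + 4*(p*q) + 4*(q*q) - 4*((a-b+1)*(p+q)) + 4*a = 0" by linarith
  define k where "k = a - b + 1"
  \<comment> \<open>Completing the square, once for each variable, bounds \<open>p\<close> and
    \<open>q\<close> separately.\<close>
  have "(3*p-k)*(3*p-k) + 3*((2*q+p-k)*(2*q+p-k)) = 4*(k*k) - 12*a"
    using eq unfolding k_def[symmetric] by (simp add: algebra_simps)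
  moreover have "(3*q-k)*(3*q-k) + 3*((2*p+q-k)*(2*p+q-k)) = 4*(k*k) - 12*a"
    using eq unfolding k_def[symmetric] by (simp add: algebra_simps)
  ultimately have sq: "(3*p-k)*(3*p-k) \<le> 4*(k*k) - 12*a" "(3*q-k)*(3*q-k) \<le> 4*(k*k) - 12*a"
    using zero_le_square[of "2*q+p-k"] zero_le_square[of "2*p+q-k"] by linarith+
  \<comment> \<open>The largest value is 24, attained at \<open>a = 1\<close>,
    \<open>b = -1\<close>.\<close>
  have "4*(k*k) - 12*a \<le> 5*5" using ab by (auto simp: k_def)
  then have "-5 \<le> 3*p-k \<and> 3*p-k \<le> 5" "-5 \<le> 3*q-k \<and> 3*q-k \<le> 5"
    using sq int_abs_le_of_square_le[of "3*p-k" 5] int_abs_le_of_square_le[of "3*q-k" 5] by simp_all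
  moreover have "-1 \<le> k \<and> k \<le> 3" using ab by (auto simp: k_def)
  ultimately have "p = -2 \<or> p = -1 \<or> p = 0 \<or> p = 1 \<or> p = 2"
    "q = -2 \<or> q = -1 \<or> q = 0 \<or> q = 1 \<or> q = 2" by presburger+
  with ab eq s r show ?thesis by - (elim disjE; simp add: pqrs)
qed

text \<open>Infinite descent at 2: the form is odd unless both arguments are even, so every zero can
  be halved.\<close>

lemma indefinite_form_zero:
  fixes u v :: int
  assumes "u*u + u*v - v*v = 0"
  shows "u = 0 \<and> v = 0"
  using assms
proof (induction "nat \<bar>u\<bar>" arbitrary: u v rule: less_induct)
  case less
  have "even (u*u + u*v - v*v)" using less.prems by simp
  then have "even u" "even v" by auto
  then obtain a b where ab: "u = 2*a" "v = 2*b" by (auto elim!: evenE)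
  have "a*a + a*b - b*b = 0" using less.prems ab by (simp add: algebra_simps)
  moreover have "nat \<bar>a\<bar> < nat \<bar>u\<bar> \<or> u = 0" using ab by auto
  ultimately have "a = 0 \<and> b = 0 \<or> u = 0" using less.hyps[of a b] by blast
  then show ?case using less.prems ab by auto
qed

text \<open>After the linear elimination the conic is a hyperbola, so no bound is available and
  arithmetic replaces the search: for \<open>a = 1\<close> the conic is an anisotropic form around
  the point (1, 1), for \<open>a = -1\<close> a congruence excludes integer points.\<close>

lemma phi_clique_completion:
  fixes B :: "int mat"
  assumes B: "B \<in> carrier_mat 2 2"
    and dets: "det22 B = a" "det22 (B - 1\<^sub>m 2) = -1" "det22 (B - phi_mat) = 1"
    and a: "a = 1 \<or> a = -1"
  shows "B = phi_mat + 1\<^sub>m 2"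
proof -
  obtain p q r s where pqrs: "B = mat22 p q r s" using B by (rule mat22_cases)
  have s: "s = a + 2 - p" and r: "r = 2 - a + p - q" and det: "p*s - q*r = a"
    using dets by (simp_all add: pqrs one_mat22 phi_mat22 algebra_simps)
  have eq: "p*p + p*q - q*q - (a+2)*p + (2-a)*q + a = 0"
    using det unfolding s r by (simp add: algebra_simps)
  from a show ?thesis
  proof
    assume [simp]: "a = 1"
    have "(p-1)*(p-1) + (p-1)*(q-1) - (q-1)*(q-1) = 0"
      using eq by (simp add: algebra_simps)
    then have "p = 1" "q = 1" using indefinite_form_zero[of "p-1" "q-1"] by auto
    then show ?thesis by (simp add: pqrs s r phi_mat22 one_mat22)
  next
    assume [simp]: "a = -1"
    \<comment> \<open>The form \<open>u\<^sup>2 + u v - v\<^sup>2\<close> is anisotropic modulo 3, so its values divisible by 3 are divisible by 9.\<close>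
    define u v where "u = 5*p+1" and "v = 5*q-7"
    \<comment> \<open>The centre of the conic is (-1/5, 7/5); \<open>u\<close> and \<open>v\<close>
      are the coordinates relative to it, scaled by 5 to be integers.\<close>
    have uv: "u*u + u*v - v*v = -30"
      using eq unfolding u_def v_def by (simp add: algebra_simps)
    have "3 dvd u \<and> 3 dvd v"
    proof -
      have "((u mod 3)*(u mod 3) + (u mod 3)*(v mod 3) - (v mod 3)*(v mod 3)) mod 3 =
          (u*u + u*v - v*v) mod 3"
        by (intro mod_diff_cong mod_add_cong mod_mult_cong mod_mod_trivial)
      then have "((u mod 3)*(u mod 3) + (u mod 3)*(v mod 3) - (v mod 3)*(v mod 3)) mod 3 = 0"
        unfolding uv by simp
      moreover have "u mod 3 = 0 \<or> u mod 3 = 1 \<or> u mod 3 = 2"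
        "v mod 3 = 0 \<or> v mod 3 = 1 \<or> v mod 3 = 2" by presburger+
      ultimately have "u mod 3 = 0 \<and> v mod 3 = 0" by - (elim disjE; simp)
      then show ?thesis by (simp add: dvd_eq_mod_eq_0)
    qed
    then obtain m n where "u = 3*m" "v = 3*n" by (auto elim!: dvdE)
    then have "9 * (m*m + m*n - n*n) = -30" using uv by (simp add: algebra_simps)
    then have False by presburger
    then show ?thesis ..
  qed
qed

section \<open>Conjugate completions and the classification\<close>

text \<open>Conjugation fixes 0 and 1, so it identifies completions of the same normalised triangle
  when it also fixes the third vertex.\<close>

lemma Mat2Z_clique_equiv_conj:
  assumes C: "exceptional_clique Mat2Z {0\<^sub>m 2 2, 1\<^sub>m 2, A, B}"
    and "P * Q = 1\<^sub>m 2" "P \<in> Units Mat2Z" "Q \<in> Units Mat2Z"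
  shows "clique_equiv Mat2Z {0\<^sub>m 2 2, 1\<^sub>m 2, A, B} {0\<^sub>m 2 2, 1\<^sub>m 2, P * A * Q, P * B * Q}"
proof -
  have car: "A \<in> carrier_mat 2 2" "B \<in> carrier_mat 2 2"
    using C unfolding exceptional_clique_def by (auto simp: Mat2Z_simps)
  have PQ: "P \<in> carrier_mat 2 2" "Q \<in> carrier_mat 2 2" using assms by (auto simp: Units_Mat2Z)
  have minus0: "X - 0\<^sub>m 2 2 = X" if "X \<in> carrier_mat 2 2" for X :: "int mat"
    using that by auto
  have "(\<lambda>x. P * (x - 0\<^sub>m 2 2) * Q) ` {0\<^sub>m 2 2, 1\<^sub>m 2, A, B} =
      {0\<^sub>m 2 2, 1\<^sub>m 2, P * A * Q, P * B * Q}"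
    using car PQ assms(2) by (simp add: minus0)
  then show ?thesis
    using Mat2Z_clique_equiv_affine[OF C _ assms(3,4), of "0\<^sub>m 2 2"] by simp
qed

theorem proposition9p3:
  fixes C :: "int mat set"
  assumes "exceptional_clique Mat2Z C" and "card C = 4"
  shows "clique_equiv Mat2Z C {0\<^sub>m 2 2, 1\<^sub>m 2, phi_mat, phi_mat + 1\<^sub>m 2} \<or>
         clique_equiv Mat2Z C {0\<^sub>m 2 2, 1\<^sub>m 2, zeta_mat, 1\<^sub>m 2 - phi_mat} \<or>
         clique_equiv Mat2Z C {0\<^sub>m 2 2, 1\<^sub>m 2, zeta_mat, phi_mat - 1\<^sub>m 2}"
proof -
  have car: "x \<in> carrier_mat 2 2" if "x \<in> C" for x
    using assms(1) that unfolding exceptional_clique_def by (auto simp: Mat2Z_simps)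
  have det: "det22 (x - y) = 1 \<or> det22 (x - y) = -1" if "x \<in> C" "y \<in> C" "x \<noteq> y" for x y
    using assms(1) that Mat2Z_minus[OF car car] unfolding exceptional_clique_def
    by (metis Units_Mat2Z)
  define S where "S x y \<longleftrightarrow> det22 (x - y) = 1" for x y :: "int mat"
  have dS: "det22 (x - y) = (if S x y then 1 else -1)" if "x \<in> C" "y \<in> C" "x \<noteq> y" for x y
    using det[OF that] by (auto simp: S_def)
  have "\<forall>x\<in>C. \<forall>y\<in>C. S x y \<longleftrightarrow> S y x"
    using det22_minus_commute[OF car car] by (simp add: S_def)
  then show ?thesis
  proof (cases rule: two_colouring_K4[OF assms(2), consumes 1, case_names mono path])
    case (mono x0 x1 x2 x3)
    have in_C: "x0 \<in> C" "x1 \<in> C" "x2 \<in> C" "x3 \<in> C" using mono(1) by auto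
    have ne: "x1 \<noteq> x0" "x2 \<noteq> x0" "x2 \<noteq> x1" "x3 \<noteq> x0" "x3 \<noteq> x1" "x3 \<noteq> x2" using mono(2) by auto
    have "det22 (x2 - x0) = 1 * det22 (x1 - x0)" "det22 (x2 - x1) = 1 * det22 (x1 - x0)"
      using mono(3,4) in_C ne by (simp_all add: dS)
    then obtain f where f: "clique_equiv Mat2Z C (f ` C)"
      "f x0 = 0\<^sub>m 2 2" "f x1 = 1\<^sub>m 2" "f x2 = mat22 0 1 (-1) 1"
      "\<And>x. x \<in> C \<Longrightarrow> f x \<in> carrier_mat 2 2"
      "\<And>x y. x \<in> C \<Longrightarrow> y \<in> C \<Longrightarrow> det22 (f x - f y) = det22 (x1 - x0) * det22 (x - y)"
      using normalise_triangle[OF assms(1) in_C(1-3) ne(1), of 1] by auto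
    have fC: "f ` C = {0\<^sub>m 2 2, 1\<^sub>m 2, zeta_mat, f x3}"
      unfolding mono(1) using f(2-4) by (simp add: zeta_mat22)
    define B where "B = f x3"
    have B: "B \<in> carrier_mat 2 2" using f(5) in_C by (simp add: B_def)
    have "B - 0\<^sub>m 2 2 = B" using B by auto
    \<comment> \<open>The edges from \<open>x3\<close> to \<open>x1\<close> and \<open>x2\<close>
      have equal sign, so the last two determinants agree.\<close>
    then have "det22 B = det22 (x1 - x0) * det22 (x3 - x0)"
      "det22 (B - 1\<^sub>m 2) = det22 (x1 - x0) * det22 (x3 - x1)"
      "det22 (B - zeta_mat) = det22 (x1 - x0) * det22 (x3 - x1)"
      using f(6)[OF in_C(4,1)] f(6)[OF in_C(4,2)] f(6)[OF in_C(4,3)] mono(5) in_C ne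
      by (simp_all add: f(2-4) B_def zeta_mat22 dS)
    then have "B \<in> {mat22 1 1 1 0, mat22 (-1) 1 (-1) 2, mat22 1 (-1) (-1) 0,
        mat22 1 (-1) 1 (-2), mat22 (-1) (-1) (-1) 0, mat22 (-1) 1 1 0}"
      by (rule zeta_clique_completions[OF B]) (use in_C ne in \<open>auto simp: dS\<close>)
    moreover have CB: "clique_equiv Mat2Z C {0\<^sub>m 2 2, 1\<^sub>m 2, zeta_mat, B}"
      using f(1) fC by (simp add: B_def)
    moreover have "clique_equiv Mat2Z C {0\<^sub>m 2 2, 1\<^sub>m 2, P * zeta_mat * Q, P * B * Q}"
      if "P * Q = 1\<^sub>m 2" "P \<in> Units Mat2Z" "Q \<in> Units Mat2Z" for P Q
    proof -
      have "exceptional_clique Mat2Z {0\<^sub>m 2 2, 1\<^sub>m 2, zeta_mat, B}"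
        using CB unfolding clique_equiv_def by simp
      from Mat2Z.clique_equiv_trans[OF CB Mat2Z_clique_equiv_conj[OF this that]] show ?thesis .
    qed
    \<comment> \<open>Conjugation by \<open>zeta_mat\<close> and by its square, both of which fix
      \<open>zeta_mat\<close>; the cube is -1 and acts trivially. The six completions split by trace
      into the orbit of \<open>1 - phi\<close> (trace 1) and that of \<open>phi - 1\<close> (trace
      -1), with three members each.\<close>
    from this[of "mat22 1 (-1) 1 0" zeta_mat] this[of "mat22 0 (-1) 1 (-1)" "mat22 (-1) 1 (-1) 0"]
    have "clique_equiv Mat2Z C {0\<^sub>m 2 2, 1\<^sub>m 2, zeta_mat, mat22 1 (-1) 1 0 * B * zeta_mat}"
      "clique_equiv Mat2Z C {0\<^sub>m 2 2, 1\<^sub>m 2, zeta_mat, mat22 0 (-1) 1 (-1) * B * mat22 (-1) 1 (-1) 0}"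
      by (simp_all add: zeta_mat22 one_mat22 Units_Mat2Z)
    ultimately show ?thesis
      by (auto simp: zeta_mat22 phi_mat22 one_mat22)
  next
    case (path x0 x1 x2 x3)
    have in_C: "x0 \<in> C" "x1 \<in> C" "x2 \<in> C" "x3 \<in> C" using path(1) by auto
    have ne: "x1 \<noteq> x0" "x2 \<noteq> x0" "x2 \<noteq> x1" "x3 \<noteq> x0" "x3 \<noteq> x1" "x3 \<noteq> x2" using path(2) by auto
    have "det22 (x2 - x0) = -1 * det22 (x1 - x0)" "det22 (x2 - x1) = -1 * det22 (x1 - x0)"
      using path(3,4) in_C ne by (simp_all add: dS)
    then obtain f where f: "clique_equiv Mat2Z C (f ` C)"
      "f x0 = 0\<^sub>m 2 2" "f x1 = 1\<^sub>m 2" "f x2 = mat22 0 1 1 1"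
      "\<And>x. x \<in> C \<Longrightarrow> f x \<in> carrier_mat 2 2"
      "\<And>x y. x \<in> C \<Longrightarrow> y \<in> C \<Longrightarrow> det22 (f x - f y) = det22 (x1 - x0) * det22 (x - y)"
      using normalise_triangle[OF assms(1) in_C(1-3) ne(1), of "-1"] by auto
    have B: "f x3 \<in> carrier_mat 2 2" using f(5) in_C by simp
    then have "f x3 - 0\<^sub>m 2 2 = f x3" by auto
    \<comment> \<open>Relative to the edge from \<open>x1\<close> to \<open>x0\<close>, the edges
      from \<open>x3\<close> to \<open>x1\<close> and \<open>x2\<close> have opposite and equal
      sign; the free edge leaves the first determinant open.\<close>
    then have "det22 (f x3) = det22 (x1 - x0) * det22 (x3 - x0)"
      "det22 (f x3 - 1\<^sub>m 2) = -1" "det22 (f x3 - phi_mat) = 1"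
      using f(6)[OF in_C(4,1)] f(6)[OF in_C(4,2)] f(6)[OF in_C(4,3)] path(5,6) in_C ne
      by (simp_all add: f(2-4) phi_mat22 dS)
    then have "f x3 = phi_mat + 1\<^sub>m 2"
      by (rule phi_clique_completion[OF B]) (use in_C ne in \<open>auto simp: dS\<close>)
    then have "f ` C = {0\<^sub>m 2 2, 1\<^sub>m 2, phi_mat, phi_mat + 1\<^sub>m 2}"
      unfolding path(1) using f(2-4) by (simp add: phi_mat22)
    then show ?thesis using f(1) by simp
  qed
qed

end
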